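(* Let $Q=(q(i,j))_{i,j\in\mathbb{Z}_+}$ be an ergodic generator with stationary distribution vector $\pi=(\pi(i))_{i\in\mathbb{Z}_+}$. Suppose there exist $b\in(0,\infty)$, a column vector $v=(v(i))_{i\in\mathbb{Z}_+}$ with $v(i)\ge1$ for all $i$, and a finite set $C\subset\mathbb{Z}_+$ such that: (1) $\sum_{j\in\mathbb{Z}_+}q(i,j)v(j)\le -|q(i,i)|-1+b\,1_{C}(i)$ for all $i\in\mathbb{Z}_+$; (2) $\displaystyle\sup_{i\in\mathbb{Z}_+\setminus C}\Big\{\sum_{j\in\mathbb{Z}_+\setminus C}\frac{q(i,j)}{|q(i,i)|+1}\,\max(v(j)-v(i),0)\Big\}<\infty$; (3) for each $n\in\{1,2,\dots\}$ and $\nu\in\{0,1,\dots,n\}$ there exists $b_{n,\nu}\in(0,\infty)$ such that $\sum_{j=0}^n[{}_{[n]}Q_{\langle\nu\rangle}]_{i,j}\,v(j)\le -|q(i,i)|-1+b_{n,\nu}1_C(i)$ for all $i\in\{0,1,\dots,n\}$. Then $$\lim_{n\to\infty}{}_{[n]}F=\lim_{n\to\infty}\begin{pmatrix}{}_{[n]}\pi_{\langle0\rangle}\\ {}_{[n]}\pi_{\langle1\rangle}\\ \vdots\\ {}_{[n]}\pi_{\langle n\rangle}\end{pmatrix}=e\pi,$$ where the limit is entrywise, i.e. $\lim_{n\to\infty}[{}_{[n]}F]_{i,j}=\pi(j)$ for all $i,j\in\mathbb{Z}_+$.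
   Context: $\mathbb{Z}_+=\{0,1,2,\dots\}$. An ergodic generator is the infinitesimal generator ($Q$-matrix) $Q=(q(i,j))_{i,j\in\mathbb{Z}_+}$ of an ergodic (irreducible and positive recurrent, hence non-explosive) continuous-time Markov chain on $\mathbb{Z}_+$; thus $\sum_{j}q(i,j)=0$, $q(i,i)\in(-\infty,0)$ and $q(i,j)\ge 0$ for $j\ne i$. Its stationary distribution vector $\pi$ is the unique positive row vector with $\pi Q=0$ and $\pi e=1$, where $e$ is a column vector of ones of appropriate order. ${}_{[n]}Q=(q(i,j))_{0\le i,j\le n}$ is the $(n+1)\times(n+1)$ northwest-corner truncation of $Q$; it is nonsingular and $(-{}_{[n]}Q)^{-1}\ge O$. $1_C$ is the indicator function of $C$. The normalized fundamental matrix of ${}_{[n]}Q$ is ${}_{[n]}F=\mathrm{diag}^{-1}\{(-{}_{[n]}Q)^{-1}e\}(-{}_{[n]}Q)^{-1}$, where $\mathrm{diag}\{x\}$ is the diagonal matrix with diagonal $x$ (so each row of $(-{}_{[n]}Q)^{-1}$ is divided by its sum). For $\nu\in\{0,\dots,n\}$, ${}_{[n]}e_{\langle\nu\rangle}$ is the $(n+1)\times1$ unit vector with one in position $\nu$; ${}_{[n]}Q_{\langle\nu\rangle}={}_{[n]}Q-({}_{[n]}Qe)\,{}_{[n]}e_{\langle\nu\rangle}^{\top}$ is the $\nu$-th-column-augmented truncation of $Q$; and ${}_{[n]}\pi_{\langle\nu\rangle}={}_{[n]}e_{\langle\nu\rangle}^{\top}(-{}_{[n]}Q)^{-1}/({}_{[n]}e_{\langle\nu\rangle}^{\top}(-{}_{[n]}Q)^{-1}e)$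 is its stationary distribution vector, which equals the $\nu$-th row of ${}_{[n]}F$. *)

theory Defs
  imports "HOL-Probability.Distributions" "Jordan_Normal_Form.Gauss_Jordan_Elimination"
begin

hide_const (open) Finite_Cartesian_Product.vec Finite_Cartesian_Product.mat
  Determinants.det Finite_Cartesian_Product.row Finite_Cartesian_Product.transpose
no_notation Finite_Cartesian_Product.vec_nth (infixl \<open>$\<close> 90)
no_notation Inner_Product.real_inner_class.inner (infixl \<open>\<bullet>\<close> 70)

definition stable_conservative :: "(nat \<Rightarrow> nat \<Rightarrow> real) \<Rightarrow> bool" where
  "stable_conservative Q \<longleftrightarrow>
     (\<forall>i. Q i i < 0) \<and> (\<forall>i j. i \<noteq> j \<longrightarrow> 0 \<le> Q i j) \<and> (\<forall>i. (Q i has_sum 0) UNIV)"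

definition jump_prob :: "(nat \<Rightarrow> nat \<Rightarrow> real) \<Rightarrow> nat \<Rightarrow> nat \<Rightarrow> real" where
  "jump_prob Q i j = (if i = j then 0 else Q i j / \<bar>Q i i\<bar>)"

text \<open>A sample point \<open>\<omega>\<close> lists the successively visited states \<open>fst (\<omega> k)\<close> and the holding
  times \<open>snd (\<omega> k)\<close>.  The predicate characterises the law, started in \<open>i\<close>, of the minimal chain
  with generator \<open>Q\<close>: the visited states form a discrete-time Markov chain with transition matrix
  \<open>jump_prob Q\<close> and, given these states, the holding times are independent and exponentially
  distributed with rates \<open>- Q y y\<close>.\<close>

definition chain_law ::
    "(nat \<Rightarrow> nat \<Rightarrow> real) \<Rightarrow> nat \<Rightarrow> (nat \<Rightarrow> nat \<times> real) measure \<Rightarrow> bool" where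
  "chain_law Q i M \<longleftrightarrow>
     prob_space M \<and>
     sets M = sets (PiM UNIV (\<lambda>k::nat. count_space (UNIV :: nat set) \<Otimes>\<^sub>M (borel :: real measure))) \<and>
     (\<forall>n y A. (\<forall>k\<le>n. A k \<in> sets (borel :: real measure)) \<longrightarrow>
        measure M {\<omega> \<in> space M. \<forall>k\<le>n. fst (\<omega> k) = y k \<and> snd (\<omega> k) \<in> A k} =
          of_bool (y 0 = i) * (\<Prod>k<n. jump_prob Q (y k) (y (Suc k))) *
          (\<Prod>k\<le>n. measure (density lborel (\<lambda>x. ennreal (exponential_density (- Q (y k) (y k)) x))) (A k)))"

definition jump_time :: "(nat \<Rightarrow> nat \<times> real) \<Rightarrow> nat \<Rightarrow> real" where
  "jump_time \<omega> n = (\<Sum>k<n. snd (\<omega> k))"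

text \<open>The state at time \<open>t\<close>; it is \<open>None\<close> from the explosion time on.\<close>

definition state_at :: "(nat \<Rightarrow> nat \<times> real) \<Rightarrow> real \<Rightarrow> nat option" where
  "state_at \<omega> t =
     (if \<exists>n. t < jump_time \<omega> (Suc n) then Some (fst (\<omega> (LEAST n. t < jump_time \<omega> (Suc n))))
      else None)"

text \<open>The first time at or after the first jump at which the chain is in \<open>i\<close>; it is \<open>\<infinity>\<close> if
  there is no such time.\<close>

definition return_time :: "nat \<Rightarrow> (nat \<Rightarrow> nat \<times> real) \<Rightarrow> ennreal" where
  "return_time i \<omega> = (INF t\<in>{t. jump_time \<omega> 1 \<le> t \<and> state_at \<omega> t = Some i}. ennreal t)"

definition irreducible_chain :: "(nat \<Rightarrow> (nat \<Rightarrow> nat \<times> real) measure) \<Rightarrow> bool" where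
  "irreducible_chain P \<longleftrightarrow>
     (\<forall>i j. 0 < measure (P i) {\<omega> \<in> space (P i). \<exists>t\<ge>0. state_at \<omega> t = Some j})"

definition positive_recurrent_chain :: "(nat \<Rightarrow> (nat \<Rightarrow> nat \<times> real) measure) \<Rightarrow> bool" where
  "positive_recurrent_chain P \<longleftrightarrow> (\<forall>i. (\<integral>\<^sup>+ \<omega>. return_time i \<omega> \<partial>P i) < \<infinity>)"

text \<open>Non-explosion need not be demanded: an irreducible chain whose return times have finite
  mean returns infinitely often almost surely.\<close>

definition ergodic_generator :: "(nat \<Rightarrow> nat \<Rightarrow> real) \<Rightarrow> bool" where
  "ergodic_generator Q \<longleftrightarrow>
     stable_conservative Q \<and>
     (\<exists>P. (\<forall>i. chain_law Q i (P i)) \<and> irreducible_chain P \<and> positive_recurrent_chain P)"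

definition stationary_distribution :: "(nat \<Rightarrow> nat \<Rightarrow> real) \<Rightarrow> (nat \<Rightarrow> real) \<Rightarrow> bool" where
  "stationary_distribution Q p \<longleftrightarrow>
     (\<forall>i. 0 < p i) \<and> (p has_sum 1) UNIV \<and> (\<forall>j. ((\<lambda>i. p i * Q i j) has_sum 0) UNIV)"

text \<open>Row vectors \<open>x\<^sup>T A\<close> are written as \<open>transpose_mat A *\<^sub>v x\<close>.\<close>

definition nw_trunc :: "(nat \<Rightarrow> nat \<Rightarrow> real) \<Rightarrow> nat \<Rightarrow> real mat" where
  "nw_trunc Q n = mat (n + 1) (n + 1) (\<lambda>(i, j). Q i j)"

definition ones :: "nat \<Rightarrow> real vec" where
  "ones n = vec (n + 1) (\<lambda>_. 1)"

text \<open>Only meaningful for nonsingular matrices.\<close>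

definition minv :: "real mat \<Rightarrow> real mat" where
  "minv A = the (mat_inverse A)"

definition fundamental_mat :: "(nat \<Rightarrow> nat \<Rightarrow> real) \<Rightarrow> nat \<Rightarrow> real mat" where
  "fundamental_mat Q n =
     minv (mat_diag (n + 1) (\<lambda>i. (minv (- nw_trunc Q n) *\<^sub>v ones n) $ i)) * minv (- nw_trunc Q n)"

definition col_augmented :: "(nat \<Rightarrow> nat \<Rightarrow> real) \<Rightarrow> nat \<Rightarrow> nat \<Rightarrow> real mat" where
  "col_augmented Q n \<nu> =
     nw_trunc Q n -
     mat_of_cols (n + 1) [nw_trunc Q n *\<^sub>v ones n] * mat_of_rows (n + 1) [unit_vec (n + 1) \<nu>]"

definition trunc_stationary :: "(nat \<Rightarrow> nat \<Rightarrow> real) \<Rightarrow> nat \<Rightarrow> nat \<Rightarrow> real vec" where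
  "trunc_stationary Q n \<nu> =
     (1 / (unit_vec (n + 1) \<nu> \<bullet> (minv (- nw_trunc Q n) *\<^sub>v ones n))) \<cdot>\<^sub>v
     (transpose_mat (minv (- nw_trunc Q n)) *\<^sub>v unit_vec (n + 1) \<nu>)"

end

theory Submission
  imports Defs "Jordan_Normal_Form.Determinant"
begin

text \<open>Fix a row \<open>i\<close> and normalise row \<open>i\<close> of \<open>(- nw_trunc Q n)\<^sup>-\<^sup>1\<close> to have diagonal entry one.  The
  resulting row \<open>x\<^sub>n\<close> (the mean sojourn times in a cycle from \<open>i\<close>, cut off at the exit from
  \<open>{0..n}\<close>, in units of the mean sojourn time at \<open>i\<close>) solves \<open>(x\<^sub>n Q) j = 0\<close> for \<open>j \<noteq> i\<close> with
  \<open>j \<le> n\<close>.  A minimum principle shows that it increases with \<open>n\<close> and stays below \<open>\<pi> / \<pi> i\<close>.  The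
  drift condition bounds \<open>\<Sum>\<^sub>k x\<^sub>n k * \<bar>Q k k\<bar>\<close> uniformly in \<open>n\<close>, so no mass escapes and the limit
  \<open>x\<close> satisfies \<open>x Q = 0\<close> also at \<open>i\<close>.  Then \<open>\<pi> / \<pi> i - x\<close> is nonnegative, invariant and zero at
  \<open>i\<close>, hence zero by irreducibility.  Normalising \<open>x\<^sub>n\<close> to total mass one gives the claim.\<close>

section \<open>Irreducibility: from sample paths to rates\<close>

text \<open>A path leading out of a closed set contains a jump of probability zero. There are only
  countably many finite paths, so a state outside is almost surely never reached, against
  \<open>irreducible_chain\<close>.\<close>

lemma closed_set_trivial_of_ergodic:
  assumes "ergodic_generator Q" and closed: "\<And>k j. k \<in> S \<Longrightarrow> j \<notin> S \<Longrightarrow> Q k j = 0"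
  shows "S = {} \<or> S = UNIV"
proof (rule ccontr)
  assume "\<not> ?thesis"
  then obtain i j where ij: "i \<in> S" "j \<notin> S" by auto
  obtain P where P: "\<And>i. chain_law Q i (P i)" "irreducible_chain P"
    using assms(1) by (auto simp: ergodic_generator_def)
  define M where "M = P i"
  have law: "chain_law Q i M" by (simp add: M_def P)
  interpret prob_space M using law by (simp add: chain_law_def)
  have sets_M [measurable_cong]:
    "sets M = sets (PiM UNIV (\<lambda>k::nat. count_space (UNIV :: nat set) \<Otimes>\<^sub>M (borel :: real measure)))"
    using law by (simp add: chain_law_def)
  \<comment> \<open>Paths are coded by lists because these form a countable type. Reading a short
    list past its end gives an unspecified but fixed value, which does no harm in
    \<open>E_null\<close>.\<close>
  define E where "E n ys = {\<omega> \<in> space M. \<forall>k\<le>n. fst (\<omega> k) = ys ! k}" for n :: nat and ys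
  have [measurable]: "E n ys \<in> sets M" for n ys
    unfolding E_def by measurable
  have E_null: "E n ys \<in> null_sets M" if "ys ! n = j" for n ys
  proof -
    have "(\<forall>k\<le>n. A k \<in> sets borel) \<longrightarrow>
        measure M {\<omega> \<in> space M. \<forall>k\<le>n. fst (\<omega> k) = ys ! k \<and> snd (\<omega> k) \<in> A k} =
          of_bool (ys ! 0 = i) * (\<Prod>k<n. jump_prob Q (ys ! k) (ys ! Suc k)) *
          (\<Prod>k\<le>n. measure (density lborel (\<lambda>x. ennreal (exponential_density (- Q (ys ! k) (ys ! k)) x))) (A k))"
      for A :: "nat \<Rightarrow> real set"
      using law unfolding chain_law_def by blast
    from this[of "\<lambda>_. UNIV"] have m: "measure M (E n ys) =
          of_bool (ys ! 0 = i) * (\<Prod>k<n. jump_prob Q (ys ! k) (ys ! Suc k)) *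
          (\<Prod>k\<le>n. measure (density lborel (\<lambda>x. ennreal (exponential_density (- Q (ys ! k) (ys ! k)) x))) UNIV)"
      by (simp add: E_def)
    have "measure M (E n ys) = 0"
    proof (rule ccontr)
      assume "measure M (E n ys) \<noteq> 0"
      then have s: "ys ! 0 = i" "\<And>k. k < n \<Longrightarrow> jump_prob Q (ys ! k) (ys ! Suc k) \<noteq> 0"
        using m by auto
      have "k \<le> n \<Longrightarrow> ys ! k \<in> S" for k
      proof (induction k)
        case (Suc k)
        then show ?case
          using s(2)[of k] closed[of "ys ! k" "ys ! Suc k"] by (auto simp: jump_prob_def split: if_splits)
      qed (use s ij in auto)
      with that ij show False by auto
    qed
    then show ?thesis by (intro null_setsI) (auto simp: emeasure_eq_measure)
  qed
  define A where "A = {\<omega> \<in> space M. \<exists>t\<ge>0. state_at \<omega> t = Some j}"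
  have "A \<subseteq> (\<Union>(n, ys) \<in> {(n, ys). ys ! n = j}. E n ys)"
  proof
    fix \<omega> assume w: "\<omega> \<in> A"
    then obtain n where n: "fst (\<omega> n) = j"
      by (auto simp: A_def state_at_def split: if_splits)
    define ys where "ys = map (\<lambda>k. fst (\<omega> k)) [0..<Suc n]"
    have ys: "ys ! k = fst (\<omega> k)" if "k \<le> n" for k
      using that unfolding ys_def by (subst nth_map) (auto simp del: upt_Suc)
    then have "\<omega> \<in> E n ys" "ys ! n = j" using w n by (auto simp: E_def A_def)
    then show "\<omega> \<in> (\<Union>(n, ys) \<in> {(n, ys). ys ! n = j}. E n ys)" by blast
  qed
  moreover have "(\<Union>(n, ys) \<in> {(n, ys). ys ! n = j}. E n ys) \<in> null_sets M"
    by (intro null_sets_UN') (auto simp: E_null)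
  \<comment> \<open>If \<open>A\<close> is not in \<open>sets M\<close>, its \<open>measure\<close>
    is 0 by convention; otherwise it is a measurable part of a null set.\<close>
  ultimately have "measure M A = 0"
    by (metis null_sets_subset measure_eq_0_null_sets measure_notin_sets)
  moreover have "0 < measure M A"
    using P(2) by (auto simp: irreducible_chain_def M_def A_def)
  ultimately show False by simp
qed

section \<open>Series and matrix inverses\<close>

lemma tendsto_suminf_dominated:
  fixes a :: "nat \<Rightarrow> nat \<Rightarrow> real"
  assumes "\<And>k. (\<lambda>n. a n k) \<longlonglongrightarrow> c k" and "\<And>n k. \<bar>a n k\<bar> \<le> M k" and "summable M"
  shows "(\<lambda>n. \<Sum>k. a n k) \<longlonglongrightarrow> (\<Sum>k. c k)"
proof -
  have "\<forall>\<^sub>F (k, n) in sequentially \<times>\<^sub>F sequentially. norm (a n k) \<le> M k"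
    by (rule always_eventually) (auto simp: assms)
  then show ?thesis
    using tannerys_theorem[of "\<lambda>k n. a n k" c sequentially M] assms by simp
qed

lemma has_sum_real_summable_abs:
  fixes f :: "nat \<Rightarrow> real"
  assumes "(f has_sum s) UNIV"
  shows "f sums s" "summable (\<lambda>k. \<bar>f k\<bar>)"
proof -
  show "f sums s" using assms by (rule has_sum_imp_sums)
  have "(\<lambda>k. \<bar>f k\<bar>) summable_on UNIV"
    using assms summable_on_iff_abs_summable_on_real[of f UNIV]
    by (auto simp: has_sum_imp_summable)
  then show "summable (\<lambda>k. \<bar>f k\<bar>)" by (rule summable_on_imp_summable)
qed

lemma minv_inverse:
  fixes A :: "real mat"
  assumes "A \<in> carrier_mat n n" "det A \<noteq> 0"
  shows "minv A \<in> carrier_mat n n" "minv A * A = 1\<^sub>m n" "A * minv A = 1\<^sub>m n"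
proof -
  obtain B where B: "mat_inverse A = Some B"
    using mat_inverse(1)[OF assms(1)] det_non_zero_imp_unit[OF assms] by fastforce
  then show "minv A \<in> carrier_mat n n" "minv A * A = 1\<^sub>m n" "A * minv A = 1\<^sub>m n"
    using mat_inverse(2)[OF assms(1) B] by (auto simp: minv_def)
qed

lemma minv_unique:
  fixes A B :: "real mat"
  assumes "A \<in> carrier_mat n n" "B \<in> carrier_mat n n" "B * A = 1\<^sub>m n" "A * B = 1\<^sub>m n"
  shows "minv A = B"
proof -
  have "det B * det A = 1" using assms det_mult[of B n A] by simp
  then have "det A \<noteq> 0" by auto
  note A = minv_inverse[OF assms(1) this]
  have "minv A = minv A * (A * B)" using A assms by simp
  also have "\<dots> = minv A * A * B" using A assms by (intro assoc_mult_mat[symmetric]) auto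
  also have "\<dots> = B" using A assms by simp
  finally show ?thesis .
qed

lemma nw_trunc_carrier: "nw_trunc Q n \<in> carrier_mat (n + 1) (n + 1)"
  by (simp add: nw_trunc_def)

lemmas nw_trunc_carrier_Suc [simp] = nw_trunc_carrier[unfolded Suc_eq_plus1[symmetric]]

section \<open>Minimum principle and Green matrix of a truncation\<close>

text \<open>Irreducibility takes the form \<open>closed_trivial\<close> because the arguments
  exhibit the set where a desired relation fails, show that it is closed, and conclude that it is
  empty.\<close>

locale irreducible_rates =
  fixes Q :: "nat \<Rightarrow> nat \<Rightarrow> real"
  assumes stable: "stable_conservative Q"
    and closed_trivial: "(\<And>k j. k \<in> S \<Longrightarrow> j \<notin> S \<Longrightarrow> Q k j = 0) \<Longrightarrow> S = {} \<or> S = UNIV"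
begin

lemma Q_diag: "Q i i < 0" and Q_off: "i \<noteq> j \<Longrightarrow> 0 \<le> Q i j" and Q_row: "(Q i has_sum 0) UNIV"
  using stable by (auto simp: stable_conservative_def)

lemma sum_Q_nonpos: "finite N \<Longrightarrow> k \<in> N \<Longrightarrow> (\<Sum>j\<in>N. Q k j) \<le> 0"
  by (rule finite_sum_le_has_sum[OF Q_row]) (auto intro: Q_off)

text \<open>If \<open>z\<close> is negative exactly on \<open>N\<close>, then \<open>\<Sum>\<^sub>k\<^sub>\<le>\<^sub>n z k * (\<Sum>\<^sub>j\<^sub>\<in>\<^sub>N Q k j)\<close> has nonnegative terms
  and a nonpositive value, which makes the finite set \<open>N\<close> closed under the transitions of \<open>Q\<close>.\<close>

lemma left_minimum_principle:
  assumes neg: "\<And>j. j \<le> n \<Longrightarrow> z j < 0 \<Longrightarrow> (\<Sum>k\<le>n. z k * Q k j) \<le> 0" and "j \<le> n"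
  shows "0 \<le> z j"
proof -
  define N where "N = {j. j \<le> n \<and> z j < 0}"
  have N: "finite N" "N \<subseteq> {..n}" by (auto simp: N_def)
  have terms: "0 \<le> z k * (\<Sum>j\<in>N. Q k j)" if "k \<le> n" for k
  proof (cases "k \<in> N")
    case True
    then show ?thesis using sum_Q_nonpos[OF N(1) True] by (auto simp: N_def mult_nonpos_nonpos)
  next
    case False
    then have "0 \<le> (\<Sum>j\<in>N. Q k j)" by (intro sum_nonneg Q_off) auto
    then show ?thesis using False that by (simp add: N_def)
  qed
  have "(\<Sum>k\<le>n. z k * (\<Sum>j\<in>N. Q k j)) = (\<Sum>j\<in>N. \<Sum>k\<le>n. z k * Q k j)"
    by (simp add: sum_distrib_left) (rule sum.swap)
  also have "\<dots> \<le> 0" by (rule sum_nonpos) (auto simp: N_def neg)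
  finally have "(\<Sum>k\<le>n. z k * (\<Sum>j\<in>N. Q k j)) = 0"
    using terms by (meson antisym atMost_iff sum_nonneg)
  then have terms0: "\<forall>k\<in>{..n}. z k * (\<Sum>j\<in>N. Q k j) = 0"
    using terms by (subst (asm) sum_nonneg_eq_0_iff) auto
  then have zero: "(\<Sum>j\<in>N. Q k j) = 0" if "k \<in> N" for k
  proof -
    have "z k * (\<Sum>j\<in>N. Q k j) = 0" using that N terms0 by blast
    then show ?thesis using that unfolding N_def by simp
  qed
  \<comment> \<open>The row sums over \<open>N\<close> already vanish, and adjoining
    \<open>j\<close> keeps them nonpositive, so the rate from \<open>k\<close> to \<open>j\<close>
    cannot be positive.\<close>
  have "Q k j = 0" if "k \<in> N" "j \<notin> N" for k j
  proof -
    have "(\<Sum>l\<in>insert j N. Q k l) \<le> 0" using that N by (intro sum_Q_nonpos) auto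
    then have "Q k j \<le> 0" using that N zero[of k] by simp
    moreover have "0 \<le> Q k j" using that by (intro Q_off) auto
    ultimately show ?thesis by simp
  qed
  from closed_trivial[of N, OF this] have "N = {}" using N(1) by auto
  then show ?thesis using assms(2) by (auto simp: N_def not_less)
qed

text \<open>The minimum principle applies to a left null vector and to its negative, so both are
  nonnegative.\<close>

lemma det_nw_trunc: "det (- nw_trunc Q n) \<noteq> 0"
proof
  assume "det (- nw_trunc Q n) = 0"
  then have "det (transpose_mat (nw_trunc Q n)) = 0"
    by (simp add: det_0_negate[OF nw_trunc_carrier] det_transpose[OF nw_trunc_carrier])
  then obtain w where w: "w \<in> carrier_vec (n + 1)" "w \<noteq> 0\<^sub>v (n + 1)"
      "transpose_mat (nw_trunc Q n) *\<^sub>v w = 0\<^sub>v (n + 1)"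
    using det_0_iff_vec_prod_zero[of "transpose_mat (nw_trunc Q n)" "n + 1"] by auto
  have zero: "(\<Sum>k\<le>n. w $ k * Q k j) = 0" if "j \<le> n" for j
  proof -
    have "(transpose_mat (nw_trunc Q n) *\<^sub>v w) $ j = 0" using w(3) that by simp
    then show ?thesis using that w(1)
      by (simp add: nw_trunc_def scalar_prod_def atLeast0LessThan lessThan_Suc_atMost mult.commute)
  qed
  have "w $ j = 0" if "j \<le> n" for j
    using left_minimum_principle[of n "\<lambda>k. w $ k" j] left_minimum_principle[of n "\<lambda>k. - w $ k" j]
      zero that by (simp add: sum_negf)
  then have "w = 0\<^sub>v (n + 1)" using w(1) by (intro eq_vecI) auto
  with w(2) show False by simp
qed

text \<open>For \<open>i\<close> and \<open>j\<close> up to \<open>n\<close>, the mean time spent in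
  \<open>j\<close> before leaving \<open>{0..n}\<close>, starting from \<open>i\<close>.\<close>

definition green :: "nat \<Rightarrow> nat \<Rightarrow> nat \<Rightarrow> real" where
  "green n i j = minv (- nw_trunc Q n) $$ (i, j)"

lemma green_carrier: "minv (- nw_trunc Q n) \<in> carrier_mat (n + 1) (n + 1)"
  by (rule minv_inverse(1)[OF _ det_nw_trunc]) simp

lemma green_mult:
  assumes "i \<le> n" "j \<le> n"
  shows "(\<Sum>k\<le>n. green n i k * Q k j) = - of_bool (i = j)"
proof -
  have "(minv (- nw_trunc Q n) * - nw_trunc Q n) $$ (i, j) = 1\<^sub>m (n + 1) $$ (i, j)"
    by (subst minv_inverse(2)[OF _ det_nw_trunc]) auto
  then show ?thesis using assms green_carrier[of n]
    by (simp add: nw_trunc_def scalar_prod_def atLeast0LessThan lessThan_Suc_atMost green_def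
        sum_negf split: if_splits)
qed

lemma green_nonneg: "i \<le> n \<Longrightarrow> j \<le> n \<Longrightarrow> 0 \<le> green n i j"
  by (rule left_minimum_principle[of n]) (auto simp: green_mult)

text \<open>The mean time spent in the starting state is at least one mean holding time.
  Algebraically, the off-diagonal terms of column \<open>i\<close> in \<open>green_mult\<close> are
  nonnegative.\<close>

lemma green_diag: "i \<le> n \<Longrightarrow> 1 \<le> green n i i * \<bar>Q i i\<bar>"
proof -
  assume i: "i \<le> n"
  have "-1 = green n i i * Q i i + (\<Sum>k\<in>{..n} - {i}. green n i k * Q k i)"
    using green_mult[OF i i] i by (simp add: sum.remove)
  moreover have "0 \<le> (\<Sum>k\<in>{..n} - {i}. green n i k * Q k i)"
    using i by (intro sum_nonneg mult_nonneg_nonneg green_nonneg Q_off) auto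
  ultimately show ?thesis using Q_diag[of i] by simp
qed

lemma green_diag_pos: "i \<le> n \<Longrightarrow> 0 < green n i i"
  using green_diag[of i n] green_nonneg[of i n i] by (cases "green n i i = 0") auto

lemma inverse_green_diag: "i \<le> n \<Longrightarrow> 1 / green n i i \<le> \<bar>Q i i\<bar>"
  using green_diag[of i n] green_diag_pos[of i n] by (simp add: field_simps)

lemma fundamental_mat_entry:
  assumes "i \<le> n" "j \<le> n"
  shows "fundamental_mat Q n $$ (i, j) = green n i j / (\<Sum>k\<le>n. green n i k)"
proof -
  let ?s = "\<lambda>i. (minv (- nw_trunc Q n) *\<^sub>v ones n) $ i"
  have s: "?s i = (\<Sum>k\<le>n. green n i k)" if "i \<le> n" for i
    using that green_carrier[of n]
    by (simp add: ones_def scalar_prod_def atLeast0LessThan lessThan_Suc_atMost green_def)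
  \<comment> \<open>Positive row sums make \<open>1 / ?s i\<close> a genuine inverse on the
    diagonal.\<close>
  have pos: "0 < (\<Sum>k\<le>n. green n i k)" if "i \<le> n" for i
    using that by (intro sum_pos2[of _ i]) (auto intro: green_nonneg green_diag_pos)
  have eq: "mat_diag (n + 1) (\<lambda>i. ?s i * (1 / ?s i)) = (1\<^sub>m (n + 1) :: real mat)"
  proof (rule eq_matI)
    show "mat_diag (n + 1) (\<lambda>i. ?s i * (1 / ?s i)) $$ (k, l) = (1\<^sub>m (n + 1) :: real mat) $$ (k, l)"
      if "k < dim_row (1\<^sub>m (n + 1) :: real mat)" "l < dim_col (1\<^sub>m (n + 1) :: real mat)" for k l
    proof -
      have "k \<le> n" using that by simp
      then have "?s k \<noteq> 0" using s[of k] pos[of k] by linarith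
      then show ?thesis using that by (cases "k = l") (simp_all add: mat_diag_def)
    qed
  qed (simp_all add: mat_diag_def)
  have "minv (mat_diag (n + 1) ?s) = mat_diag (n + 1) (\<lambda>i. 1 / ?s i)"
    using eq by (intro minv_unique) (simp_all add: mult.commute)
  then have "fundamental_mat Q n
      = Matrix.mat (n + 1) (n + 1) (\<lambda>(i, j). 1 / ?s i * minv (- nw_trunc Q n) $$ (i, j))"
    unfolding fundamental_mat_def by (simp only: mat_diag_mult_left[OF green_carrier])
  then have "fundamental_mat Q n $$ (i, j) = 1 / ?s i * green n i j"
    using assms by (simp add: green_def)
  then show ?thesis using s[OF assms(1)] by simp
qed

lemma trunc_stationary_entry:
  assumes "i \<le> n" "j \<le> n"
  shows "trunc_stationary Q n i $ j = green n i j / (\<Sum>k\<le>n. green n i k)"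
proof -
  have carrier: "minv (- nw_trunc Q n) *\<^sub>v ones n \<in> carrier_vec (n + 1)"
    by (rule mult_mat_vec_carrier[OF green_carrier]) (simp add: ones_def)
  have "unit_vec (n + 1) i \<bullet> (minv (- nw_trunc Q n) *\<^sub>v ones n) = (\<Sum>k\<le>n. green n i k)"
  proof (subst scalar_prod_left_unit[OF carrier])
    show "(minv (- nw_trunc Q n) *\<^sub>v ones n) $ i = (\<Sum>k\<le>n. green n i k)"
      using assms green_carrier[of n]
      by (simp add: ones_def scalar_prod_def atLeast0LessThan lessThan_Suc_atMost green_def)
  qed (use assms in simp)
  moreover have "(transpose_mat (minv (- nw_trunc Q n)) *\<^sub>v unit_vec (n + 1) i) $ j = green n i j"
    using assms green_carrier[of n] by (simp add: green_def)
  moreover have "dim_row (minv (- nw_trunc Q n)) = n + 1" using green_carrier[of n] by auto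
  ultimately show ?thesis
    using assms green_carrier[of n] by (simp add: trunc_stationary_def)
qed

section \<open>Sojourn times in a truncated cycle\<close>

text \<open>The row \<open>x\<^sub>n\<close>, extended by zero so that it is monotone in \<open>n\<close> from \<open>n = 0\<close> on.\<close>

definition cycle :: "nat \<Rightarrow> nat \<Rightarrow> nat \<Rightarrow> real" where
  "cycle i n j = (if i \<le> n \<and> j \<le> n then green n i j / green n i i else 0)"

lemma cycle_nonneg: "0 \<le> cycle i n j"
  by (auto simp: cycle_def intro!: divide_nonneg_nonneg green_nonneg)

lemma cycle_self: "i \<le> n \<Longrightarrow> cycle i n i = 1"
  using green_diag_pos[of i n] by (simp add: cycle_def)

lemma cycle_mult:
  assumes "i \<le> n" "j \<le> n"
  shows "(\<Sum>k\<le>n. cycle i n k * Q k j) = - of_bool (i = j) / green n i i"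
proof -
  have "(\<Sum>k\<le>n. cycle i n k * Q k j) = (\<Sum>k\<le>n. green n i k * Q k j) / green n i i"
    using assms by (simp add: cycle_def sum_divide_distrib)
  then show ?thesis using assms by (simp add: green_mult)
qed

text \<open>The minimum principle is applied to \<open>u - cycle i n\<close>. It tests only columns
  where this difference is negative; column \<open>i\<close>, where the equation for
  \<open>cycle\<close> has a defect, is exempt because both vectors are 1 there.\<close>

lemma cycle_le:
  assumes nonneg: "\<And>k. 0 \<le> u k" and "u i = 1"
    and super: "\<And>j. j \<le> n \<Longrightarrow> j \<noteq> i \<Longrightarrow> (\<Sum>k\<le>n. u k * Q k j) \<le> 0"
  shows "cycle i n j \<le> u j"
proof (cases "i \<le> n \<and> j \<le> n")
  case True
  have "0 \<le> u j - cycle i n j"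
  proof (rule left_minimum_principle[of n "\<lambda>j. u j - cycle i n j"])
    fix j assume j: "j \<le> n" "u j - cycle i n j < 0"
    then have "j \<noteq> i" using cycle_self[of i n] assms True by auto
    then show "(\<Sum>k\<le>n. (u k - cycle i n k) * Q k j) \<le> 0"
      using super[of j] cycle_mult[of i n j] True j
      by (simp add: left_diff_distrib sum_subtractf)
  qed (use True in auto)
  then show ?thesis by simp
next
  case False
  then show ?thesis using nonneg[of j] by (auto simp: cycle_def)
qed

text \<open>Deleting state \<open>Suc n\<close> from the larger cycle removes a nonnegative inflow
  from each column other than \<open>i\<close>, so \<open>cycle_le\<close> applies to what
  remains.\<close>

lemma cycle_mono: "incseq (\<lambda>n. cycle i n j)"
proof (rule incseq_SucI)
  fix n
  show "cycle i n j \<le> cycle i (Suc n) j"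
  proof (cases "i \<le> n")
    case True
    show ?thesis
    proof (rule cycle_le)
      fix j assume j: "j \<le> n" "j \<noteq> i"
      have "(\<Sum>k\<le>Suc n. cycle i (Suc n) k * Q k j) = 0"
        using j True by (subst cycle_mult) auto
      moreover have "0 \<le> cycle i (Suc n) (Suc n) * Q (Suc n) j"
        using j by (intro mult_nonneg_nonneg cycle_nonneg Q_off) auto
      ultimately show "(\<Sum>k\<le>n. cycle i (Suc n) k * Q k j) \<le> 0" by simp
    qed (use True cycle_nonneg cycle_self in auto)
  next
    case False
    then show ?thesis by (simp add: cycle_def[of i n] cycle_nonneg)
  qed
qed

text \<open>Turns sums of growing length into series over a fixed index set, ready for dominated
  convergence.\<close>

lemma suminf_cycle: "(\<Sum>k. cycle i n k * f k) = (\<Sum>k\<le>n. cycle i n k * f k)"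
  by (rule suminf_finite) (auto simp: cycle_def)

lemma green_ratio_eq_cycle_ratio:
  assumes "i \<le> n" "j \<le> n"
  shows "green n i j / (\<Sum>k\<le>n. green n i k) = cycle i n j / (\<Sum>k. cycle i n k)"
proof -
  have "(\<Sum>k. cycle i n k) = (\<Sum>k\<le>n. green n i k) / green n i i"
    using suminf_cycle[of i n "\<lambda>_. 1"] assms by (simp add: cycle_def sum_divide_distrib)
  then show ?thesis using assms green_diag_pos[of i n] by (simp add: cycle_def)
qed

text \<open>Weight the drift inequality by \<open>cycle\<close> and interchange the sums: only
  column \<open>i\<close> survives, and its defect is at most \<open>\<bar>Q i i\<bar>\<close> by
  \<open>inverse_green_diag\<close>. Cutting the rows at \<open>n\<close> drops nonnegative terms
  only.\<close>

lemma cycle_drift: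
  assumes "i \<le> n" and v: "\<And>k. 0 \<le> v k"
    and drift: "\<And>k. (\<lambda>j. Q k j * v j) summable_on UNIV"
      "\<And>k. (\<Sum>\<^sub>\<infinity>j. Q k j * v j) \<le> - f k + d k"
  shows "(\<Sum>k\<le>n. cycle i n k * f k) \<le> \<bar>Q i i\<bar> * v i + (\<Sum>k\<le>n. cycle i n k * d k)"
proof -
  have "(\<Sum>j\<le>n. Q k j * v j) \<le> - f k + d k" if "k \<le> n" for k
  proof -
    have "(\<Sum>j\<le>n. Q k j * v j) \<le> (\<Sum>\<^sub>\<infinity>j. Q k j * v j)"
      using that by (intro finite_sum_le_infsum drift) (auto intro!: mult_nonneg_nonneg Q_off v)
    with drift(2)[of k] show ?thesis by simp
  qed
  then have "(\<Sum>k\<le>n. cycle i n k * (\<Sum>j\<le>n. Q k j * v j)) \<le> (\<Sum>k\<le>n. cycle i n k * (- f k + d k))"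
    by (intro sum_mono mult_left_mono cycle_nonneg) auto
  moreover have "(\<Sum>k\<le>n. cycle i n k * (\<Sum>j\<le>n. Q k j * v j))
      = (\<Sum>j\<le>n. (\<Sum>k\<le>n. cycle i n k * Q k j) * v j)"
    by (simp add: sum_distrib_left sum_distrib_right mult.assoc) (rule sum.swap)
  moreover have "\<dots> = (\<Sum>j\<le>n. if i = j then - v i / green n i i else 0)"
    using assms(1) by (intro sum.cong) (auto simp: cycle_mult)
  moreover have "\<dots> = - (1 / green n i i * v i)" using assms(1) by simp
  moreover have "1 / green n i i * v i \<le> \<bar>Q i i\<bar> * v i"
    using assms(1) by (intro mult_right_mono inverse_green_diag v)
  ultimately show ?thesis by (simp add: algebra_simps sum.distrib sum_subtractf)
qed

section \<open>Passage to the limit\<close>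

lemma cycle_limit:
  assumes pi: "stationary_distribution Q \<pi>" and v: "\<And>k. 0 \<le> v k" and "finite C" "0 \<le> b"
    and drift: "\<And>k. (\<lambda>j. Q k j * v j) summable_on UNIV"
      "\<And>k. (\<Sum>\<^sub>\<infinity>j. Q k j * v j) \<le> - \<bar>Q k k\<bar> + b * indicat_real C k"
  shows "(\<lambda>n. cycle i n j) \<longlonglongrightarrow> \<pi> j / \<pi> i"
proof -
  define u where "u j = \<pi> j / \<pi> i" for j
  have pi_pos: "0 < \<pi> k" for k using pi by (simp add: stationary_distribution_def)
  have u_nonneg: "0 \<le> u k" for k using pi_pos by (simp add: u_def less_imp_le)
  have u_Q: "((\<lambda>k. u k * Q k j) has_sum 0) UNIV" for j
  proof -
    have "((\<lambda>k. \<pi> k * Q k j) has_sum 0) UNIV" using pi by (simp add: stationary_distribution_def)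
    from has_sum_cmult_right[OF this, of "1 / \<pi> i"] show ?thesis by (simp add: u_def)
  qed
  have le_u: "cycle i n j \<le> u j" for n j
  proof (rule cycle_le)
    show "(\<Sum>k\<le>n. u k * Q k j) \<le> 0" if "j \<le> n" for j
      using that by (intro finite_sum_le_has_sum[OF u_Q])
        (auto intro!: mult_nonneg_nonneg u_nonneg Q_off)
  qed (use pi_pos[of i] u_nonneg in \<open>auto simp: u_def\<close>)
  define x where "x j = lim (\<lambda>n. cycle i n j)" for j
  have lim: "(\<lambda>n. cycle i n j) \<longlonglongrightarrow> x j" for j
  proof -
    have "convergent (\<lambda>n. cycle i n j)"
      by (rule incseq_convergent[OF cycle_mono[of i j], of "u j"]) (auto simp: le_u convergent_def)
    then show ?thesis by (simp add: x_def convergent_LIMSEQ_iff)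
  qed
  have cycle_le_x: "cycle i n j \<le> x j" for n j by (rule incseq_le[OF cycle_mono lim])
  have x_nonneg: "0 \<le> x j" for j by (rule order_trans[OF cycle_nonneg cycle_le_x[of 0]])
  have x_le_u: "x j \<le> u j" for j by (rule LIMSEQ_le_const2[OF lim]) (auto simp: le_u)
  have x_i: "x i = 1"
    by (rule LIMSEQ_unique[OF lim]) (auto intro!: tendsto_eventually eventually_sequentiallyI[of i] cycle_self)

  \<comment> \<open>The majorant comes from invariance of \<open>u\<close>: a convergent
    \<open>has_sum\<close> over the reals is absolutely convergent.\<close>
  have x_Q_lim: "(\<lambda>n. \<Sum>k\<le>n. cycle i n k * Q k j) \<longlonglongrightarrow> (\<Sum>k. x k * Q k j)" for j
    unfolding suminf_cycle[symmetric]
  proof (rule tendsto_suminf_dominated)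
    show "(\<lambda>n. cycle i n k * Q k j) \<longlonglongrightarrow> x k * Q k j" for k
      by (intro tendsto_intros lim)
    show "\<bar>cycle i n k * Q k j\<bar> \<le> \<bar>u k * Q k j\<bar>" for n k
      using le_u[of n k] cycle_nonneg[of i n k] by (auto simp: abs_mult intro!: mult_right_mono)
    show "summable (\<lambda>k. \<bar>u k * Q k j\<bar>)" by (rule has_sum_real_summable_abs[OF u_Q])
  qed

  have summable_exit: "summable (\<lambda>k. x k * \<bar>Q k k\<bar>)"
  proof (rule bounded_imp_summable)
    show "0 \<le> x k * \<bar>Q k k\<bar>" for k using x_nonneg by simp
    \<comment> \<open>This bound depends on neither \<open>m\<close> nor \<open>n\<close>:
      \<open>cycle_drift\<close> reduces the sum to the finite set \<open>C\<close>, where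
      \<open>u\<close> dominates.\<close>
    let ?K = "\<bar>Q i i\<bar> * v i + (\<Sum>k\<in>C. u k * b)"
    fix m
    have "(\<lambda>n. \<Sum>k\<le>m. cycle i n k * \<bar>Q k k\<bar>) \<longlonglongrightarrow> (\<Sum>k\<le>m. x k * \<bar>Q k k\<bar>)"
      by (intro tendsto_intros lim)
    moreover have "(\<Sum>k\<le>m. cycle i n k * \<bar>Q k k\<bar>) \<le> ?K" if "max i m \<le> n" for n
    proof -
      have "(\<Sum>k\<le>m. cycle i n k * \<bar>Q k k\<bar>) \<le> (\<Sum>k\<le>n. cycle i n k * \<bar>Q k k\<bar>)"
        using that by (intro sum_mono2) (auto simp: cycle_nonneg)
      also have "\<dots> \<le> \<bar>Q i i\<bar> * v i + (\<Sum>k\<le>n. cycle i n k * (b * indicat_real C k))"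
        using that by (intro cycle_drift v drift) auto
      also have "(\<Sum>k\<le>n. cycle i n k * (b * indicat_real C k)) = (\<Sum>k\<in>{..n} \<inter> C. cycle i n k * b)"
        by (intro sum.mono_neutral_cong_right) auto
      also have "\<dots> \<le> (\<Sum>k\<in>C. cycle i n k * b)"
        using assms by (intro sum_mono2) (auto simp: cycle_nonneg)
      also have "\<dots> \<le> (\<Sum>k\<in>C. u k * b)"
        using assms by (intro sum_mono mult_right_mono le_u) auto
      finally show ?thesis by simp
    qed
    then have "\<forall>n\<ge>max i m. (\<Sum>k\<le>m. cycle i n k * \<bar>Q k k\<bar>) \<le> ?K" by blast
    ultimately show "(\<Sum>k\<le>m. x k * \<bar>Q k k\<bar>) \<le> ?K"
      by (rule LIMSEQ_le_const2[OF _ exI])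
  qed

  \<comment> \<open>\<open>r n k\<close> is the rate of leaving \<open>{0..n}\<close> from \<open>k\<close>, and \<open>\<Sum>\<^sub>k x\<^sub>n k * r n k\<close> equals the
    defect \<open>- (x\<^sub>n Q) i\<close>.\<close>
  define r where "r n k = - (\<Sum>j\<le>n. Q k j)" for n k
  have r_bound: "\<bar>r n k\<bar> \<le> \<bar>Q k k\<bar>" if "k \<le> n" for n k
  proof -
    have "0 \<le> (\<Sum>j\<in>{..n} - {k}. Q k j)" by (intro sum_nonneg Q_off) auto
    moreover have "(\<Sum>j\<le>n. Q k j) = Q k k + (\<Sum>j\<in>{..n} - {k}. Q k j)"
      using that by (simp add: sum.remove)
    moreover have "(\<Sum>j\<le>n. Q k j) \<le> 0" using that by (intro sum_Q_nonpos) auto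
    ultimately show ?thesis by (simp add: r_def)
  qed
  \<comment> \<open>Here \<open>- 0\<close> is the limit of \<open>r n k\<close>, minus a full row
    sum. The majorant from \<open>summable_exit\<close> prevents a loss of mass at infinity.\<close>
  have "(\<lambda>n. \<Sum>k. cycle i n k * r n k) \<longlonglongrightarrow> (\<Sum>k. x k * - 0)"
  proof (rule tendsto_suminf_dominated[OF _ _ summable_exit])
    show "(\<lambda>n. cycle i n k * r n k) \<longlonglongrightarrow> x k * - 0" for k
      unfolding r_def using has_sum_real_summable_abs(1)[OF Q_row[of k]]
      by (intro tendsto_intros lim) (simp add: sums_def_le)
    show "\<bar>cycle i n k * r n k\<bar> \<le> x k * \<bar>Q k k\<bar>" for n k
    proof (cases "k \<le> n")
      case True
      then show ?thesis
        by (simp add: abs_mult cycle_nonneg) (intro mult_mono r_bound cycle_le_x x_nonneg, auto)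
    qed (simp add: cycle_def x_nonneg)
  qed
  then have "(\<lambda>n. - (\<Sum>k\<le>n. cycle i n k * r n k)) \<longlonglongrightarrow> 0"
    by (simp add: suminf_cycle tendsto_minus_cancel_left[symmetric])
  \<comment> \<open>Summed over all columns up to \<open>n\<close>, the entries of the row times
    \<open>Q\<close> vanish except in column \<open>i\<close>.\<close>
  moreover have "- (\<Sum>k\<le>n. cycle i n k * r n k) = (\<Sum>k\<le>n. cycle i n k * Q k i)" if "i \<le> n" for n
  proof -
    have "- (\<Sum>k\<le>n. cycle i n k * r n k) = (\<Sum>j\<le>n. \<Sum>k\<le>n. cycle i n k * Q k j)"
      by (simp add: r_def sum_negf sum_distrib_left) (rule sum.swap)
    also have "\<dots> = (\<Sum>j\<le>n. if j = i then \<Sum>k\<le>n. cycle i n k * Q k i else 0)"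
      using that by (intro sum.cong) (auto simp: cycle_mult)
    finally show ?thesis using that by simp
  qed
  then have "\<forall>\<^sub>F n in sequentially.
      - (\<Sum>k\<le>n. cycle i n k * r n k) = (\<Sum>k\<le>n. cycle i n k * Q k i)"
    by (rule eventually_sequentiallyI)
  ultimately have "(\<lambda>n. \<Sum>k\<le>n. cycle i n k * Q k i) \<longlonglongrightarrow> 0"
    by (rule Lim_transform_eventually)
  then have x_Q_i: "(\<Sum>k. x k * Q k i) = 0" using x_Q_lim[of i] LIMSEQ_unique by blast
  have x_Q: "(\<Sum>k. x k * Q k j) = 0" for j
  proof (cases "j = i")
    case False
    have "(\<lambda>n. \<Sum>k\<le>n. cycle i n k * Q k j) \<longlonglongrightarrow> 0"
      using False by (intro tendsto_eventually eventually_sequentiallyI[of "max i j"])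
        (auto simp: cycle_mult)
    then show ?thesis using x_Q_lim[of j] LIMSEQ_unique by blast
  qed (use x_Q_i in simp)

  \<comment> \<open>Where \<open>u\<close> and \<open>x\<close> agree at \<open>j\<close>, the
    diagonal term of column \<open>j\<close> vanishes and the other terms are nonnegative with sum
    zero. Agreement thus passes back to every state that can jump to \<open>j\<close>, so the set of
    disagreement is closed.\<close>
  have zero: "u k = x k" if "u j = x j" "k \<noteq> j" "Q k j \<noteq> 0" for j k
  proof -
    have "summable (\<lambda>k. x k * Q k j)"
      by (rule summable_comparison_test'[OF has_sum_real_summable_abs(2)[OF u_Q[of j]], of 0])
        (use x_le_u x_nonneg u_nonneg in \<open>auto simp: abs_mult intro!: mult_right_mono\<close>)
    then have "(\<lambda>k. x k * Q k j) sums 0" using x_Q[of j] by (simp add: sums_iff)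
    from sums_diff[OF has_sum_real_summable_abs(1)[OF u_Q[of j]] this]
    have s: "(\<lambda>k. (u k - x k) * Q k j) sums 0" by (simp add: left_diff_distrib)
    have "0 \<le> (u k - x k) * Q k j" for k
      using that(1) x_le_u[of k] Q_off[of k j] by (cases "k = j") auto
    with s have "(u k - x k) * Q k j = 0"
      using suminf_eq_zero_iff[of "\<lambda>k. (u k - x k) * Q k j"] by (auto simp: sums_iff)
    then show ?thesis using that by simp
  qed
  have "{k. u k \<noteq> x k} = {} \<or> {k. u k \<noteq> x k} = UNIV"
  proof (rule closed_trivial)
    show "Q k l = 0" if "k \<in> {k. u k \<noteq> x k}" "l \<notin> {k. u k \<noteq> x k}" for k l
      using zero[of l k] that by auto
  qed
  moreover have "u i = x i" using x_i pi_pos[of i] by (simp add: u_def)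
  ultimately have "u j = x j" by auto
  then show ?thesis using lim[of j] by (simp add: u_def)
qed

text \<open>The limit of \<open>cycle\<close> is also its summable majorant, so the total masses
  tend to \<open>1 / \<pi> i\<close>; dividing cancels \<open>\<pi> i\<close>.\<close>

lemma green_ratio_limit:
  assumes pi: "stationary_distribution Q \<pi>" and "\<And>k. 0 \<le> v k" "finite C" "0 \<le> b"
      "\<And>k. (\<lambda>j. Q k j * v j) summable_on UNIV"
      "\<And>k. (\<Sum>\<^sub>\<infinity>j. Q k j * v j) \<le> - \<bar>Q k k\<bar> + b * indicat_real C k"
  shows "(\<lambda>n. green n i j / (\<Sum>k\<le>n. green n i k)) \<longlonglongrightarrow> \<pi> j"
proof -
  note lim = cycle_limit[OF assms]
  have pi_pos: "0 < \<pi> k" for k using pi by (simp add: stationary_distribution_def)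
  have pi_sum: "(\<pi> has_sum 1) UNIV" using pi by (simp add: stationary_distribution_def)
  have sums: "(\<lambda>k. \<pi> k / \<pi> i) sums (1 / \<pi> i)"
    using sums_divide[OF has_sum_real_summable_abs(1)[OF pi_sum], of "\<pi> i"] .
  have "(\<lambda>n. \<Sum>k. cycle i n k) \<longlonglongrightarrow> (\<Sum>k. \<pi> k / \<pi> i)"
  proof (rule tendsto_suminf_dominated[OF lim])
    show "\<bar>cycle i n k\<bar> \<le> \<pi> k / \<pi> i" for n k
      using incseq_le[OF cycle_mono lim[of i k], of n] cycle_nonneg[of i n k] by simp
    show "summable (\<lambda>k. \<pi> k / \<pi> i)" using sums by (simp add: sums_iff)
  qed
  then have "(\<lambda>n. \<Sum>k. cycle i n k) \<longlonglongrightarrow> 1 / \<pi> i" using sums by (simp add: sums_iff)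
  from tendsto_divide[OF lim[of i j] this]
  have "(\<lambda>n. cycle i n j / (\<Sum>k. cycle i n k)) \<longlonglongrightarrow> \<pi> j"
    using pi_pos[of i] by simp
  then show ?thesis
    by (rule Lim_transform_eventually)
      (auto intro!: eventually_sequentiallyI[of "max i j"] simp: green_ratio_eq_cycle_ratio)
qed

end


theorem corollary2p1:
  fixes Q :: "nat \<Rightarrow> nat \<Rightarrow> real" and \<pi> :: "nat \<Rightarrow> real"
    and b :: real and v :: "nat \<Rightarrow> real" and C :: "nat set"
  assumes "ergodic_generator Q"
    and "stationary_distribution Q \<pi>"
    and "0 < b"
    and "\<And>i. 1 \<le> v i"
    and "finite C"
    and "\<And>i. (\<lambda>j. Q i j * v j) summable_on UNIV \<and>
           (\<Sum>\<^sub>\<infinity>j. Q i j * v j) \<le> - \<bar>Q i i\<bar> - 1 + b * indicat_real C i"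
    and "(SUP i\<in>- C. \<Sum>\<^sub>\<infinity>j\<in>- C. ennreal (Q i j / (\<bar>Q i i\<bar> + 1) * max (v j - v i) 0)) < \<infinity>"
    and "\<And>n \<nu>. 1 \<le> n \<Longrightarrow> \<nu> \<le> n \<Longrightarrow>
           \<exists>b' > 0. \<forall>i\<le>n. (\<Sum>j=0..n. col_augmented Q n \<nu> $$ (i, j) * v j)
             \<le> - \<bar>Q i i\<bar> - 1 + b' * indicat_real C i"
  shows "\<forall>i j. (\<lambda>n. fundamental_mat Q n $$ (i, j)) \<longlonglongrightarrow> \<pi> j \<and>
               (\<lambda>n. mat\<^sub>r (n + 1) (n + 1) (trunc_stationary Q n) $$ (i, j)) \<longlonglongrightarrow> \<pi> j"
proof (intro allI)
  fix i j
  interpret irreducible_rates Q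
  proof
    show "stable_conservative Q" using assms(1) by (simp add: ergodic_generator_def)
  qed (rule closed_set_trivial_of_ergodic[OF assms(1)])
  have v: "0 \<le> v k" for k using assms(4)[of k] by simp
  have drift: "(\<Sum>\<^sub>\<infinity>j. Q k j * v j) \<le> - \<bar>Q k k\<bar> + b * indicat_real C k" for k
    using assms(6)[of k] by simp
  have lim: "(\<lambda>n. green n i j / (\<Sum>k\<le>n. green n i k)) \<longlonglongrightarrow> \<pi> j"
    by (rule green_ratio_limit[OF assms(2) v assms(5) less_imp_le[OF assms(3)] _ drift])
      (use assms(6) in blast)
  \<comment> \<open>Entry \<open>(i, j)\<close> lies inside the truncation only from
    \<open>n = max i j\<close> on, so the sequences are compared eventually.\<close>
  have "\<forall>\<^sub>F n in sequentially. green n i j / (\<Sum>k\<le>n. green n i k) = fundamental_mat Q n $$ (i, j)"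
    by (intro eventually_sequentiallyI[of "max i j"]) (simp add: fundamental_mat_entry)
  moreover have "\<forall>\<^sub>F n in sequentially. green n i j / (\<Sum>k\<le>n. green n i k)
      = mat\<^sub>r (n + 1) (n + 1) (trunc_stationary Q n) $$ (i, j)"
    by (intro eventually_sequentiallyI[of "max i j"])
      (simp add: trunc_stationary_entry)
  ultimately show "(\<lambda>n. fundamental_mat Q n $$ (i, j)) \<longlonglongrightarrow> \<pi> j \<and>
      (\<lambda>n. mat\<^sub>r (n + 1) (n + 1) (trunc_stationary Q n) $$ (i, j)) \<longlonglongrightarrow> \<pi> j"
    by (intro conjI Lim_transform_eventually[OF lim])
qed

end
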